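(* Let $K\ge 1$ (number of seaports) and $N\ge 1$ (number of goods) be integers, let $r_j>0$ for $j\in\{1,\dots,K\}$, $c_n>0$ and $v^n_j\in\mathbb{R}$ for $n\in\{1,\dots,N\}$, $j\in\{1,\dots,K\}$, let $T_{i,j}\ge 0$ for $i,j\in\{1,\dots,K\}$, and let $g:\mathbb{R}_+\to\mathbb{R}_+$. Put $M^n_{i,j}:=v^n_j-v^n_i$. Consider the following coupled problem for unknowns $\varphi=(\varphi^n_i)_{n,i}$ (real, with $\varphi_i^n\neq 0$ for all $n,i$) and $Q=(Q^n_{i,j})_{n,i,j}$ (real). (1) For every $i\in\{1,\dots,K\}$ and $n\in\{1,\dots,N\}$, with $\varphi$ held fixed, the vector $(Q^n_{i,j})_{1\le j\le K}$ maximizes, over all $q\in\mathbb{R}^K$ with $\sum_{j=1}^K q_j=1$, the quantity $$\sum_{j=1}^{K} \varphi_{i}^{n} q_j M^n_{i,j} - \sum_{j=1}^{K} r_j \Bigl[ \sum_{m\neq n} \varphi_{j}^{m} + \varphi_{j}^{n} + \varphi_{i}^{n} q_j\Bigr]^2 - c_n \sum_{j\neq i} (\varphi_{i}^{n} q_j)^2\, g(T_{i,j}).$$ (2) For every $n\in\{1,\dots,N\}$ and $j\in\{1,\dots,K\}$: $\varphi^n_j=\sum_{i=1}^K \varphi^n_i Q^n_{i,j}$. For all $i,j\in\{1,\dots,K\}$ and $n\in\{1,\dots,N\}$ set $$\widetilde M_{i,j}^n:=\frac{M^n_{i,j}}{2},\quad w^n_{i,j}:=\frac{1}{r_j+c_n\,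 g(T_{i,j})\mathbf{1}_{\{j\neq i\}}},\quad \underline{w}_{i,j}^n:=\frac{w_{i,j}^n}{\sum_{\ell=1}^{K} w_{i,\ell}^n},\quad \varphi^{\bullet}_j:=\sum_{m=1}^{N}\varphi^m_j .$$ Then the solution of the coupled problem (1)-(2) is given by $$Q^n_{i,j} = \frac{w^n_{i,j}}{\varphi^n_i} \Bigl\{ \widetilde M_{i,j}^n - \sum_{\ell=1}^{K} \underline{w}_{i,\ell}^n \,\widetilde M_{i,\ell}^n - \Bigl[ r_j \varphi^{\bullet}_j - \sum_{\ell=1}^{K} \underline{w}_{i,\ell}^n \,r_\ell \varphi^{\bullet}_\ell\Bigr]\Bigr\} + \underline{w}^n_{i,j}\qquad\text{for all } i,j,n;$$ that is, a pair $(\varphi,Q)$ with all $\varphi^n_i\neq 0$ solves (1)-(2) if and only if $Q$ is given by this formula and (2) holds.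
   Context: Interpretation: $\varphi^n_i$ is the quantity of good $n$ available at seaport $i$ (the mean field), $Q^n_{i,j}$ is the fraction of good $n$ at seaport $i$ sent to seaport $j$ (the case $j=i$ is allowed and represents what stays at $i$), $r_j$ is a congestion-cost coefficient, $c_n g(T_{i,j})$ is a transportation-cost coefficient, $v^n_j$ is the value of good $n$ at seaport $j$, and $M^n_{i,j}$ is the commercial margin. The rows of $Q^n$ are constrained to sum to one; no nonnegativity constraint on the entries of $Q$ is imposed. $\mathbf{1}_{\{\cdot\}}$ denotes the indicator. *)

theory Defs
  imports Complex_Main
begin

text \<open>Seaports are the naturals in \<open>{1..K}\<close> and goods the naturals in \<open>{1..N}\<close>. Superscripts come
  first: \<open>\<phi> n i\<close>, \<open>Q n i j\<close> and \<open>v n j\<close> stand for \<open>\<phi>\<^sup>n\<^sub>i\<close>, \<open>Q\<^sup>n\<^sub>i\<^sub>j\<close> and \<open>v\<^sup>n\<^sub>j\<close>. Values at indices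
  outside these ranges are never used.\<close>

definition margin :: "(nat \<Rightarrow> nat \<Rightarrow> real) \<Rightarrow> nat \<Rightarrow> nat \<Rightarrow> nat \<Rightarrow> real" where
  "margin v n i j = v n j - v n i"

definition payoff ::
  "nat \<Rightarrow> nat \<Rightarrow> (nat \<Rightarrow> real) \<Rightarrow> (nat \<Rightarrow> real) \<Rightarrow> (nat \<Rightarrow> nat \<Rightarrow> real) \<Rightarrow> (nat \<Rightarrow> nat \<Rightarrow> real) \<Rightarrow>
   (real \<Rightarrow> real) \<Rightarrow> (nat \<Rightarrow> nat \<Rightarrow> real) \<Rightarrow> nat \<Rightarrow> nat \<Rightarrow> (nat \<Rightarrow> real) \<Rightarrow> real" where
  "payoff K N r c v T g \<phi> n i q =
     (\<Sum>j\<in>{1..K}. \<phi> n i * q j * margin v n i j)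
     - (\<Sum>j\<in>{1..K}. r j * ((\<Sum>m\<in>{1..N} - {n}. \<phi> m j) + \<phi> n j + \<phi> n i * q j)\<^sup>2)
     - c n * (\<Sum>j\<in>{1..K} - {i}. (\<phi> n i * q j)\<^sup>2 * g (T i j))"

definition optimal_control ::
  "nat \<Rightarrow> nat \<Rightarrow> (nat \<Rightarrow> real) \<Rightarrow> (nat \<Rightarrow> real) \<Rightarrow> (nat \<Rightarrow> nat \<Rightarrow> real) \<Rightarrow> (nat \<Rightarrow> nat \<Rightarrow> real) \<Rightarrow>
   (real \<Rightarrow> real) \<Rightarrow> (nat \<Rightarrow> nat \<Rightarrow> real) \<Rightarrow> (nat \<Rightarrow> nat \<Rightarrow> nat \<Rightarrow> real) \<Rightarrow> bool" where
  "optimal_control K N r c v T g \<phi> Q \<longleftrightarrow>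
     (\<forall>i\<in>{1..K}. \<forall>n\<in>{1..N}.
        is_arg_max (payoff K N r c v T g \<phi> n i) (\<lambda>q. (\<Sum>j\<in>{1..K}. q j) = 1) (Q n i))"

definition mean_field_balance ::
  "nat \<Rightarrow> nat \<Rightarrow> (nat \<Rightarrow> nat \<Rightarrow> real) \<Rightarrow> (nat \<Rightarrow> nat \<Rightarrow> nat \<Rightarrow> real) \<Rightarrow> bool" where
  "mean_field_balance K N \<phi> Q \<longleftrightarrow>
     (\<forall>n\<in>{1..N}. \<forall>j\<in>{1..K}. \<phi> n j = (\<Sum>i\<in>{1..K}. \<phi> n i * Q n i j))"

definition half_margin :: "(nat \<Rightarrow> nat \<Rightarrow> real) \<Rightarrow> nat \<Rightarrow> nat \<Rightarrow> nat \<Rightarrow> real" where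
  "half_margin v n i j = margin v n i j / 2"

definition weight ::
  "(nat \<Rightarrow> real) \<Rightarrow> (nat \<Rightarrow> real) \<Rightarrow> (nat \<Rightarrow> nat \<Rightarrow> real) \<Rightarrow> (real \<Rightarrow> real) \<Rightarrow> nat \<Rightarrow> nat \<Rightarrow> nat \<Rightarrow> real" where
  "weight r c T g n i j = 1 / (r j + c n * g (T i j) * of_bool (j \<noteq> i))"

definition normalized_weight ::
  "nat \<Rightarrow> (nat \<Rightarrow> real) \<Rightarrow> (nat \<Rightarrow> real) \<Rightarrow> (nat \<Rightarrow> nat \<Rightarrow> real) \<Rightarrow> (real \<Rightarrow> real) \<Rightarrow> nat \<Rightarrow> nat \<Rightarrow> nat \<Rightarrow> real" where
  "normalized_weight K r c T g n i j = weight r c T g n i j / (\<Sum>l\<in>{1..K}. weight r c T g n i l)"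

definition total_goods :: "nat \<Rightarrow> (nat \<Rightarrow> nat \<Rightarrow> real) \<Rightarrow> nat \<Rightarrow> real" where
  "total_goods N \<phi> j = (\<Sum>m\<in>{1..N}. \<phi> m j)"

end

theory Submission
  imports Defs
begin

text \<open>For fixed \<open>i\<close> and \<open>n\<close> the payoff is a separable, strictly concave quadratic in \<open>q\<close>, with
  diagonal coefficients \<open>(\<phi>\<^sup>n\<^sub>i)\<^sup>2 / w\<^sup>n\<^sub>i\<^sub>j\<close>. On a hyperplane \<open>\<Sum>\<^sub>j q\<^sub>j = 1\<close> it falls short of its value at
  the point \<open>p\<close> satisfying the Lagrange condition by exactly the weighted squared distance from \<open>q\<close>
  to \<open>p\<close>, so \<open>p\<close> is the only maximizer. The explicit formula is that Lagrange point.\<close>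

text \<open>Expanding \<open>F\<close> around \<open>p\<close> is exact, and stationarity makes
  every linear coefficient the same multiplier \<open>\<mu>\<close>; the linear part is thus
  \<open>\<mu> * (sum q A - sum p A)\<close>, which is 0 under the constraint. Uniqueness is only on
  \<open>A\<close>, since \<open>F\<close> ignores values elsewhere.\<close>

lemma is_arg_max_separable_quadratic_iff:
  fixes F :: "('a \<Rightarrow> real) \<Rightarrow> real" and a d p q :: "'a \<Rightarrow> real"
  assumes fin: "finite A"
    and pos: "\<And>j. j \<in> A \<Longrightarrow> d j > 0"
    and stationary: "\<And>j. j \<in> A \<Longrightarrow> a j - 2 * d j * p j = \<mu>"
    and sum_p: "sum p A = s"
    and F: "\<And>q. F q = C + (\<Sum>j\<in>A. a j * q j - d j * (q j)\<^sup>2)"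
  shows "is_arg_max F (\<lambda>q. sum q A = s) q \<longleftrightarrow> (\<forall>j\<in>A. q j = p j)"
proof -
  have gap: "F q = F p - (\<Sum>j\<in>A. d j * (q j - p j)\<^sup>2)" if "sum q A = s" for q
  proof -
    \<comment> \<open>Once \<open>a j\<close> is eliminated by stationarity, this is a polynomial
      identity term by term.\<close>
    have "(\<Sum>j\<in>A. a j * q j - d j * (q j)\<^sup>2)
        = (\<Sum>j\<in>A. (a j * p j - d j * (p j)\<^sup>2) - d j * (q j - p j)\<^sup>2 + \<mu> * (q j - p j))"
    proof (rule sum.cong[OF refl])
      fix j assume "j \<in> A"
      then have a: "a j = \<mu> + 2 * d j * p j"
        using stationary by force
      show "a j * q j - d j * (q j)\<^sup>2
          = (a j * p j - d j * (p j)\<^sup>2) - d j * (q j - p j)\<^sup>2 + \<mu> * (q j - p j)"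
        unfolding a by algebra
    qed
    also have "\<dots> = (\<Sum>j\<in>A. a j * p j - d j * (p j)\<^sup>2) - (\<Sum>j\<in>A. d j * (q j - p j)\<^sup>2)
        + \<mu> * (sum q A - sum p A)"
      by (simp add: sum.distrib sum_subtractf sum_distrib_left right_diff_distrib)
    finally show ?thesis
      using that sum_p by (simp add: F)
  qed
  have gap_nonneg: "0 \<le> (\<Sum>j\<in>A. d j * (q j - p j)\<^sup>2)" for q
    using pos by (intro sum_nonneg) (simp add: less_imp_le)
  show ?thesis
  proof
    assume max: "is_arg_max F (\<lambda>q. sum q A = s) q"
    then have "sum q A = s" and "F p \<le> F q"
      using sum_p by (auto simp: is_arg_max_linorder)
    then have "(\<Sum>j\<in>A. d j * (q j - p j)\<^sup>2) = 0"
      using gap gap_nonneg[of q] by fastforce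
    then have "\<forall>j\<in>A. d j * (q j - p j)\<^sup>2 = 0"
      using fin pos by (subst (asm) sum_nonneg_eq_0_iff) (auto simp: less_imp_le)
    then show "\<forall>j\<in>A. q j = p j"
      using pos by force
  next
    assume eq: "\<forall>j\<in>A. q j = p j"
    then have "sum q A = s"
      using sum_p by simp
    moreover have "F q = F p"
      using eq by (simp add: F)
    moreover have "F y \<le> F p" if "sum y A = s" for y
      using gap[OF that] gap_nonneg[of y] by simp
    ultimately show "is_arg_max F (\<lambda>q. sum q A = s) q"
      by (simp add: is_arg_max_linorder)
  qed
qed

text \<open>In the shipped amounts \<open>y j = x * q j\<close> the objective is
  \<open>2 * b j * y j - (y j)\<^sup>2 / w j\<close>, summed. Stationarity gives
  \<open>y j = w j * (b j - t)\<close> for one \<open>t\<close>, and \<open>sum y A = x\<close>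
  forces \<open>t = m - x / W\<close>, with \<open>W\<close> the total weight and \<open>m\<close>
  the weighted mean of \<open>b\<close>.\<close>

lemma is_arg_max_weighted_quadratic_iff:
  fixes F :: "('a \<Rightarrow> real) \<Rightarrow> real" and b w q :: "'a \<Rightarrow> real" and x :: real
  assumes fin: "finite A" and ne: "A \<noteq> {}"
    and pos: "\<And>j. j \<in> A \<Longrightarrow> w j > 0"
    and x: "x \<noteq> 0"
    and F: "\<And>q. F q = C + (\<Sum>j\<in>A. 2 * x * b j * q j - x\<^sup>2 / w j * (q j)\<^sup>2)"
  shows "is_arg_max F (\<lambda>q. sum q A = 1) q \<longleftrightarrow>
    (\<forall>j\<in>A. q j = w j / x * (b j - (\<Sum>l\<in>A. w l / sum w A * b l)) + w j / sum w A)"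
proof -
  define W where "W = sum w A"
  define m where "m = (\<Sum>l\<in>A. w l / W * b l)"
  have W: "W > 0"
    unfolding W_def using fin ne pos by (intro sum_pos) auto
  have Wm: "(\<Sum>l\<in>A. w l * b l) = W * m"
    using W by (simp add: m_def sum_distrib_left)
  show ?thesis
    unfolding W_def[symmetric] m_def[symmetric]
  proof (rule is_arg_max_separable_quadratic_iff[OF fin _ _ _ F])
    fix j assume j: "j \<in> A"
    show "x\<^sup>2 / w j > 0"
      using pos[OF j] x by simp
    \<comment> \<open>The multiplier is \<open>2 * x * t\<close> with
      \<open>t = m - x / W\<close>.\<close>
    show "2 * x * b j - 2 * (x\<^sup>2 / w j) * (w j / x * (b j - m) + w j / W) = 2 * x * m - 2 * x\<^sup>2 / W"
      using pos[OF j] x W by (simp add: field_simps power2_eq_square)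
  next
    \<comment> \<open>Weighted deviations from the mean \<open>m\<close> cancel, so only the
      normalized weights contribute to the sum.\<close>
    have "(\<Sum>j\<in>A. w j / x * (b j - m) + w j / W)
        = ((\<Sum>j\<in>A. w j * b j) - W * m) / x + W / W"
      by (simp add: sum.distrib sum_subtractf right_diff_distrib diff_divide_distrib
          flip: sum_divide_distrib sum_distrib_right W_def)
    then show "(\<Sum>j\<in>A. w j / x * (b j - m) + w j / W) = 1"
      using W Wm by simp
  qed
qed

text \<open>Expanding the congestion square leaves a constant, a cross term that joins the margin,
  and a pure square whose coefficient \<open>r j\<close> adds to the transport coefficient to form
  the reciprocal of \<open>weight\<close>.\<close>

lemma payoff_eq_weighted_quadratic:
  assumes "n \<in> {1..N}"
  shows "payoff K N r c v T g \<phi> n i q =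
    - (\<Sum>j\<in>{1..K}. r j * (total_goods N \<phi> j)\<^sup>2)
    + (\<Sum>j\<in>{1..K}. 2 * \<phi> n i * (half_margin v n i j - r j * total_goods N \<phi> j) * q j
        - (\<phi> n i)\<^sup>2 / weight r c T g n i j * (q j)\<^sup>2)"
proof -
  have total: "(\<Sum>m\<in>{1..N} - {n}. \<phi> m j) + \<phi> n j = total_goods N \<phi> j" for j
    using assms by (simp add: total_goods_def sum.remove[where x = n])
  \<comment> \<open>The indicator vanishes at \<open>j = i\<close>, so all sums can run over the
    same index set and be merged.\<close>
  have transport: "(\<Sum>j\<in>{1..K} - {i}. (\<phi> n i * q j)\<^sup>2 * g (T i j))
      = (\<Sum>j\<in>{1..K}. (\<phi> n i * q j)\<^sup>2 * g (T i j) * of_bool (j \<noteq> i))"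
    by (rule sum.mono_neutral_cong_left) auto
  show ?thesis
    unfolding payoff_def total transport sum_distrib_left sum_subtractf[symmetric]
      sum_negf[symmetric] sum.distrib[symmetric]
    by (rule sum.cong[OF refl]) (simp add: half_margin_def weight_def power2_eq_square algebra_simps)
qed

theorem theorem1:
  fixes K N :: nat
    and r c :: "nat \<Rightarrow> real"
    and v T :: "nat \<Rightarrow> nat \<Rightarrow> real"
    and g :: "real \<Rightarrow> real"
    and \<phi> :: "nat \<Rightarrow> nat \<Rightarrow> real"
    and Q :: "nat \<Rightarrow> nat \<Rightarrow> nat \<Rightarrow> real"
  assumes "K \<ge> 1" and "N \<ge> 1"
    and "\<forall>j\<in>{1..K}. r j > 0"
    and "\<forall>n\<in>{1..N}. c n > 0"
    and "\<forall>i\<in>{1..K}. \<forall>j\<in>{1..K}. T i j \<ge> 0"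
    and "\<forall>x\<ge>0. g x \<ge> 0"
    and "\<forall>n\<in>{1..N}. \<forall>i\<in>{1..K}. \<phi> n i \<noteq> 0"
  shows "optimal_control K N r c v T g \<phi> Q \<and> mean_field_balance K N \<phi> Q \<longleftrightarrow>
    (\<forall>i\<in>{1..K}. \<forall>j\<in>{1..K}. \<forall>n\<in>{1..N}.
       Q n i j =
         weight r c T g n i j / \<phi> n i *
           (half_margin v n i j
            - (\<Sum>l\<in>{1..K}. normalized_weight K r c T g n i l * half_margin v n i l)
            - (r j * total_goods N \<phi> j
               - (\<Sum>l\<in>{1..K}. normalized_weight K r c T g n i l * (r l * total_goods N \<phi> l))))
         + normalized_weight K r c T g n i j)
    \<and> mean_field_balance K N \<phi> Q"
proof -
  \<comment> \<open>With \<open>\<phi>\<close> fixed, optimality splits into one problem per pair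
    \<open>i\<close>, \<open>n\<close>; the balance condition is common to both sides.\<close>
  have "is_arg_max (payoff K N r c v T g \<phi> n i) (\<lambda>q. (\<Sum>j\<in>{1..K}. q j) = 1) (Q n i) \<longleftrightarrow>
      (\<forall>j\<in>{1..K}. Q n i j =
         weight r c T g n i j / \<phi> n i *
           (half_margin v n i j
            - (\<Sum>l\<in>{1..K}. normalized_weight K r c T g n i l * half_margin v n i l)
            - (r j * total_goods N \<phi> j
               - (\<Sum>l\<in>{1..K}. normalized_weight K r c T g n i l * (r l * total_goods N \<phi> l))))
         + normalized_weight K r c T g n i j)"
    if i: "i \<in> {1..K}" and n: "n \<in> {1..N}" for i n
  proof -
    \<comment> \<open>The general lemma yields one weighted mean of margin minus congestion;
      linearity separates it into the two means of the stated formula.\<close>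
    have regroup: "b - y - (\<Sum>l\<in>{1..K}. u l * (f l - h l))
        = b - (\<Sum>l\<in>{1..K}. u l * f l) - (y - (\<Sum>l\<in>{1..K}. u l * h l))"
      for b y :: real and u f h
      by (simp add: right_diff_distrib sum_subtractf)
    have "weight r c T g n i j > 0" if j: "j \<in> {1..K}" for j
    proof -
      have "r j > 0" and "c n > 0" and "g (T i j) \<ge> 0"
        using assms i n j by auto
      then show ?thesis
        unfolding weight_def by (intro divide_pos_pos add_pos_nonneg) simp_all
    qed
    moreover have "\<phi> n i \<noteq> 0"
      using assms i n by blast
    ultimately have "is_arg_max (payoff K N r c v T g \<phi> n i) (\<lambda>q. (\<Sum>j\<in>{1..K}. q j) = 1) (Q n i) \<longleftrightarrow>
        (\<forall>j\<in>{1..K}. Q n i j = weight r c T g n i j / \<phi> n i *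
           (half_margin v n i j - r j * total_goods N \<phi> j
            - (\<Sum>l\<in>{1..K}. normalized_weight K r c T g n i l
                * (half_margin v n i l - r l * total_goods N \<phi> l)))
         + normalized_weight K r c T g n i j)"
      unfolding normalized_weight_def using i
      by (intro is_arg_max_weighted_quadratic_iff[OF _ _ _ _ payoff_eq_weighted_quadratic[OF n]]) auto
    then show ?thesis
      by (simp only: regroup)
  qed
  then show ?thesis
    unfolding optimal_control_def by blast
qed

end
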